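(* Let $r\ge 1$ be a fixed integer and let $G_n=K_{1,n}$ be the star graph with $n+1$ vertices. Color the vertices of $G_n$ independently and uniformly at random with $c=c(n)$ colors, and let $T_{r,n}$ be the number of monochromatic $r$-stars in $G_n$. Then, as $n\to\infty$: (1) if $n/c\to0$, then $T_{r,n}\to 0$ in distribution; (2) if $n/c\to\infty$, then $T_{r,n}\to\infty$ (that is, $\mathbb{P}(T_{r,n}>K)\to1$ for every $K<\infty$); (3) if $n/c\to\lambda$ for some $\lambda\in(0,\infty)$, then $T_{r,n}\to \frac{X(X-1)\cdots(X-r+1)}{r!}$ in distribution, where $X\sim \mathrm{Poisson}(\lambda)$.
   Context: An $r$-star is the graph $K_{1,r}$ (one central vertex joined to $r$ leaves). A monochromatic $r$-star in $G_n=K_{1,n}$ is determined by a set of $r$ leaves of $K_{1,n}$ all having the same color as the central vertex of $K_{1,n}$; that is, $T_{r,n}=\binom{N}{r}$ where $N$ is the number of leaves with the same color as the center. *)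

theory Defs
  imports "HOL-Probability.Probability"
begin

text \<open>A simple graph is a pair of its vertex set and its edge set, an edge being the
  two-element set of its endpoints.\<close>

type_synonym 'a graph = "'a set \<times> 'a set set"

definition subgraph :: "'a graph \<Rightarrow> 'a graph \<Rightarrow> bool" where
  "subgraph H G \<longleftrightarrow> fst H \<subseteq> fst G \<and> snd H \<subseteq> snd G"

definition star_on :: "'a \<Rightarrow> 'a set \<Rightarrow> 'a graph" where
  "star_on v L = (insert v L, (\<lambda>u. {v, u}) ` L)"

definition is_star :: "nat \<Rightarrow> 'a graph \<Rightarrow> bool" where
  "is_star r H \<longleftrightarrow> (\<exists>v L. finite L \<and> card L = r \<and> v \<notin> L \<and> H = star_on v L)"

definition star_graph :: "nat \<Rightarrow> nat graph" where
  "star_graph n = star_on 0 {1..n}"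

definition monochromatic :: "('a \<Rightarrow> nat) \<Rightarrow> 'a graph \<Rightarrow> bool" where
  "monochromatic f H \<longleftrightarrow> (\<forall>u\<in>fst H. \<forall>w\<in>fst H. f u = f w)"

text \<open>Stars are counted as subgraphs, so a 1-star is counted once, although either of its
  endpoints may serve as the centre. Hence in \<open>star_graph n\<close>, for \<open>r \<ge> 1\<close>, the
  monochromatic \<open>r\<close>-stars correspond to the \<open>r\<close>-sets of leaves coloured like vertex 0.\<close>

definition mono_stars :: "nat \<Rightarrow> 'a graph \<Rightarrow> ('a \<Rightarrow> nat) \<Rightarrow> nat" where
  "mono_stars r G f = card {H. subgraph H G \<and> is_star r H \<and> monochromatic f H}"

text \<open>The colours are \<open>0, \<dots>, k - 1\<close>; the product makes the colours of distinct vertices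
  independent. Outside the vertex set a colouring is \<open>undefined\<close>.\<close>

definition random_colouring :: "'a graph \<Rightarrow> nat \<Rightarrow> ('a \<Rightarrow> nat) pmf" where
  "random_colouring G k = Pi_pmf (fst G) undefined (\<lambda>_. pmf_of_set {..<k})"

definition mono_stars_law :: "nat \<Rightarrow> nat \<Rightarrow> nat \<Rightarrow> real measure" where
  "mono_stars_law r n k =
     distr (measure_pmf (random_colouring (star_graph n) k)) borel
       (\<lambda>f. real (mono_stars r (star_graph n) f))"

end

theory Submission
  imports Defs
begin

text \<open>
  Everything depends on a single integer random variable, the number \<open>N\<close> of leaves that have
  the colour of the centre. A star with \<open>r \<ge> 1\<close> edges inside \<open>K\<^bsub>1,n\<^esub>\<close> can always be
  centred at the centre of \<open>K\<^bsub>1,n\<^esub>\<close>, so the monochromatic ones are counted by \<open>N choose r\<close>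
  (\<open>mono_stars_star_graph\<close>). Given the colour of the centre, each leaf independently agrees with
  it with probability \<open>1 / c\<close>; this probability does not depend on that colour, hence \<open>N\<close> is
  binomial with parameters \<open>n\<close> and \<open>1 / c\<close> (\<open>mono_stars_binomial\<close>).

  When \<open>n / c\<close> tends to a finite limit \<open>l \<ge> 0\<close>, the law of rare events
  (\<open>binomial_poisson_limit\<close>) gives convergence of the point probabilities of \<open>N\<close> to those
  of the Poisson distribution, with the point mass at \<open>0\<close> as the degenerate case \<open>l = 0\<close>.
  No mass is lost in the limit, so the probability of every set of integers converges
  (\<open>pmf_tendsto_imp_prob_tendsto\<close>), and this passes to the law of any function of \<open>N\<close>. When
  \<open>n / c\<close> tends to infinity, each point probability of \<open>N\<close> vanishes, because it is at most
  a constant multiple of \<open>x ^ k * exp (- x)\<close> with \<open>x = n / c\<close>; so \<open>N\<close>, and with it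
  \<open>N choose r\<close>, exceeds any bound with probability tending to one.
\<close>

section \<open>Counting monochromatic stars\<close>

text \<open>The edges of \<open>H\<close> all pass through \<open>0\<close>. Hence a star in \<open>star_graph n\<close> whose centre is
  not \<open>0\<close> has \<open>0\<close> as its only leaf, and swapping the two endpoints moves the centre to \<open>0\<close>.\<close>

lemma star_in_star_graph_iff:
  assumes "r \<ge> 1"
  shows "subgraph H (star_graph n) \<and> is_star r H \<longleftrightarrow>
    (\<exists>S. S \<subseteq> {1..n} \<and> card S = r \<and> H = star_on 0 S)"
proof (intro iffI)
  assume "subgraph H (star_graph n) \<and> is_star r H"
  then obtain v L where L: "finite L" "card L = r" "v \<notin> L" "H = star_on v L"
    and sub: "subgraph H (star_graph n)"
    by (auto simp: is_star_def)
  have verts: "insert v L \<subseteq> insert 0 {1..n}"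
    and "(\<lambda>u. {v, u}) ` L \<subseteq> (\<lambda>i. {0, i}) ` {1..n}"
    using sub unfolding L(4) by (simp_all add: subgraph_def star_graph_def star_on_def)
  then have edges: "\<exists>i\<in>{1..n}. {v, u} = {0, i}" if "u \<in> L" for u
    using that by blast
  show "\<exists>S. S \<subseteq> {1..n} \<and> card S = r \<and> H = star_on 0 S"
  proof (cases "v = 0")
    case True
    have "L \<subseteq> {1..n}" using verts L(3) True by auto
    with L True show ?thesis by blast
  next
    case False
    have "u = 0" if "u \<in> L" for u
      using edges[OF that] False by (auto simp: doubleton_eq_iff)
    moreover have "L \<noteq> {}" using L(2) assms by auto
    ultimately have L0: "L = {0}" by auto
    have "H = star_on 0 {v}"
      unfolding L(4) L0 star_on_def by auto
    moreover have "{v} \<subseteq> {1..n}" using verts False by auto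
    moreover have "card {v} = r" using L(2) L0 by simp
    ultimately show ?thesis by blast
  qed
next
  assume "\<exists>S. S \<subseteq> {1..n} \<and> card S = r \<and> H = star_on 0 S"
  then obtain S where S: "S \<subseteq> {1..n}" "card S = r" "H = star_on 0 S" by blast
  have "finite S" "0 \<notin> S" using S(1) finite_subset by auto
  then have "is_star r H" unfolding is_star_def using S by blast
  moreover have "subgraph H (star_graph n)"
    using S by (auto simp: subgraph_def star_graph_def star_on_def)
  ultimately show "subgraph H (star_graph n) \<and> is_star r H" by blast
qed

lemma monochromatic_star_on_iff:
  "monochromatic f (star_on v S) \<longleftrightarrow> (\<forall>i\<in>S. f i = f v)"
  by (auto simp: monochromatic_def star_on_def)

lemma mono_stars_star_graph:
  assumes "r \<ge> 1"
  shows "mono_stars r (star_graph n) f = card {i\<in>{1..n}. f i = f 0} choose r"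
proof -
  let ?B = "{i\<in>{1..n}. f i = f 0}"
  have "{H. subgraph H (star_graph n) \<and> is_star r H \<and> monochromatic f H}
      = star_on 0 ` {S. S \<subseteq> ?B \<and> card S = r}" (is "?lhs = ?rhs")
  proof (intro set_eqI)
    fix H
    have "H \<in> ?lhs \<longleftrightarrow> (\<exists>S. S \<subseteq> {1..n} \<and> card S = r \<and> H = star_on 0 S) \<and> monochromatic f H"
      using star_in_star_graph_iff[OF assms, of H n] by blast
    also have "\<dots> \<longleftrightarrow> (\<exists>S. S \<subseteq> {1..n} \<and> card S = r \<and> H = star_on 0 S \<and> (\<forall>i\<in>S. f i = f 0))"
      using monochromatic_star_on_iff[of f 0] by blast
    also have "\<dots> \<longleftrightarrow> H \<in> ?rhs" by blast
    finally show "H \<in> ?lhs \<longleftrightarrow> H \<in> ?rhs" .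
  qed
  moreover have "inj_on (star_on 0) {S. S \<subseteq> ?B \<and> card S = r}"
  proof (rule inj_onI)
    fix S T :: "nat set"
    assume "S \<in> {S. S \<subseteq> ?B \<and> card S = r}" "T \<in> {S. S \<subseteq> ?B \<and> card S = r}"
      and eq: "star_on 0 S = star_on 0 T"
    then have "0 \<notin> S" "0 \<notin> T" by auto
    moreover have "insert 0 S = insert 0 T"
      using eq by (simp add: star_on_def)
    ultimately show "S = T" by (metis insert_ident)
  qed
  ultimately show ?thesis
    by (simp add: mono_stars_def card_image n_subsets)
qed

section \<open>The binomial law of the number of agreeing leaves\<close>

lemma map_eq_pmf_of_set_lessThan:
  fixes y k :: nat
  assumes "y < k"
  shows "map_pmf (\<lambda>z. z = y) (pmf_of_set {..<k}) = bernoulli_pmf (1 / real k)"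
proof (rule pmf_eqI)
  fix b
  have ne: "{..<k} \<noteq> {}" using assms by auto
  have p: "0 \<le> 1 / real k" "1 / real k \<le> 1" using assms by auto
  have T: "pmf (map_pmf (\<lambda>z. z = y) (pmf_of_set {..<k})) True = 1 / real k"
  proof -
    have "{..<k} \<inter> {z. z = y} = {y}" using assms by auto
    then show ?thesis
      using ne by (simp add: pmf_map vimage_def measure_pmf_of_set)
  qed
  show "pmf (map_pmf (\<lambda>z. z = y) (pmf_of_set {..<k})) b = pmf (bernoulli_pmf (1 / real k)) b"
  proof (cases b)
    case True
    with T p show ?thesis by simp
  next
    case False
    with T p show ?thesis by (simp add: pmf_False_conv_True)
  qed
qed

text \<open>Conditioning on the centre's colour \<open>y\<close>: the agreement indicators of the leaves are
  independent Bernoulli variables whose parameter is the same for all \<open>y\<close>, so averaging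
  over \<open>y\<close> changes nothing.\<close>

lemma agreeing_leaves_binomial:
  assumes "k \<ge> 1"
  shows "map_pmf (\<lambda>f. card {i\<in>{1..n}. f i = f 0}) (random_colouring (star_graph n) k)
    = binomial_pmf n (1 / real k)"
proof -
  let ?U = "pmf_of_set {..<k}"
  let ?L = "Pi_pmf {1..n} undefined (\<lambda>_. ?U)"
  have p: "1 / real k \<in> {0..1}" using assms by auto
  have "0 \<in> {..<k}" using assms by simp
  then have ne: "{..<k} \<noteq> {}" by blast
  have cond: "map_pmf (\<lambda>g. card {i\<in>{1..n}. g i = y}) ?L = binomial_pmf n (1 / real k)"
    if "y < k" for y
  proof -
    have "binomial_pmf n (1 / real k) =
        map_pmf (\<lambda>h. card {i\<in>{1..n}. h i})
          (Pi_pmf {1..n} (undefined = y) (\<lambda>_. bernoulli_pmf (1 / real k)))"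
      using p by (intro binomial_pmf_altdef') auto
    also have "Pi_pmf {1..n} (undefined = y) (\<lambda>_. bernoulli_pmf (1 / real k))
        = Pi_pmf {1..n} (undefined = y) (\<lambda>_. map_pmf (\<lambda>z. z = y) ?U)"
      by (simp add: map_eq_pmf_of_set_lessThan[OF that])
    also have "\<dots> = map_pmf (\<lambda>h. (\<lambda>z. z = y) \<circ> h) ?L"
      by (rule Pi_pmf_map) auto
    finally show ?thesis
      by (simp add: pmf.map_comp o_def)
  qed
  have expand: "random_colouring (star_graph n) k
      = ?U \<bind> (\<lambda>y. ?L \<bind> (\<lambda>g. return_pmf (g(0 := y))))"
    unfolding random_colouring_def star_graph_def star_on_def fst_conv
    by (rule Pi_pmf_insert') auto
  have agree: "{i\<in>{1..n}. (g(0 := y)) i = (g(0 := y)) 0} = {i\<in>{1..n}. g i = y}"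
    for g :: "nat \<Rightarrow> nat" and y
    by auto
  have "map_pmf (\<lambda>f. card {i\<in>{1..n}. f i = f 0}) (random_colouring (star_graph n) k)
      = ?U \<bind> (\<lambda>y. map_pmf (\<lambda>g. card {i\<in>{1..n}. g i = y}) ?L)"
    unfolding expand map_bind_pmf map_return_pmf agree by (simp only: map_pmf_def)
  also have "\<dots> = ?U \<bind> (\<lambda>_. binomial_pmf n (1 / real k))"
    using ne by (intro bind_pmf_cong refl cond) auto
  finally show ?thesis by simp
qed

lemma mono_stars_binomial:
  assumes "r \<ge> 1" "k \<ge> 1"
  shows "map_pmf (mono_stars r (star_graph n)) (random_colouring (star_graph n) k)
    = map_pmf (\<lambda>m. m choose r) (binomial_pmf n (1 / real k))"
proof -
  have "mono_stars r (star_graph n) = (\<lambda>m. m choose r) \<circ> (\<lambda>f. card {i\<in>{1..n}. f i = f 0})"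
    using mono_stars_star_graph[OF assms(1)] by (auto simp: fun_eq_iff)
  then have "map_pmf (mono_stars r (star_graph n)) (random_colouring (star_graph n) k)
      = map_pmf (\<lambda>m. m choose r)
          (map_pmf (\<lambda>f. card {i\<in>{1..n}. f i = f 0}) (random_colouring (star_graph n) k))"
    by (simp only: pmf.map_comp)
  then show ?thesis
    by (simp only: agreeing_leaves_binomial[OF assms(2)])
qed

lemma distr_map_pmf:
  "distr (measure_pmf (map_pmf f p)) N g = distr (measure_pmf p) N (\<lambda>x. g (f x))"
  if "g \<in> UNIV \<rightarrow> space N"
  unfolding map_pmf_rep_eq using that by (subst distr_distr) (auto simp: o_def)

lemma mono_stars_law_binomial:
  assumes "r \<ge> 1" "k \<ge> 1"
  shows "mono_stars_law r n k
    = distr (measure_pmf (binomial_pmf n (1 / real k))) borel (\<lambda>m. real (m choose r))"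
proof -
  have "mono_stars_law r n k = distr (measure_pmf
      (map_pmf (mono_stars r (star_graph n)) (random_colouring (star_graph n) k))) borel real"
    unfolding mono_stars_law_def by (rule distr_map_pmf[symmetric]) simp
  also have "\<dots> = distr (measure_pmf
      (map_pmf (\<lambda>m. m choose r) (binomial_pmf n (1 / real k)))) borel real"
    by (simp only: mono_stars_binomial[OF assms])
  also have "\<dots> = distr (measure_pmf (binomial_pmf n (1 / real k))) borel (\<lambda>m. real (m choose r))"
    by (rule distr_map_pmf) simp
  finally show ?thesis .
qed

section \<open>Convergence of discrete laws\<close>

text \<open>Finitely many points of \<open>A\<close> carry almost all the limiting mass of \<open>A\<close>, so the
  probabilities of \<open>A\<close> cannot drop below the limiting one.\<close>

lemma pmf_tendsto_imp_prob_eventually_greater: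
  fixes p :: "nat \<Rightarrow> nat pmf" and q :: "nat pmf"
  assumes "\<And>k. (\<lambda>n. pmf (p n) k) \<longlonglongrightarrow> pmf q k" and "a < measure_pmf.prob q A"
  shows "\<forall>\<^sub>F n in sequentially. a < measure_pmf.prob (p n) A"
proof -
  have "(\<lambda>m. measure_pmf.prob q (A \<inter> {..<m})) \<longlonglongrightarrow> measure_pmf.prob q (\<Union>m. A \<inter> {..<m})"
    by (rule measure_pmf.finite_Lim_measure_incseq) (auto simp: incseq_def)
  also have "(\<Union>m. A \<inter> {..<m}) = A" by auto
  finally have "\<forall>\<^sub>F m in sequentially. a < measure_pmf.prob q (A \<inter> {..<m})"
    using assms(2) by (rule order_tendstoD)
  then obtain m where m: "a < measure_pmf.prob q (A \<inter> {..<m})"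
    by (auto simp: eventually_sequentially)
  have "(\<lambda>n. \<Sum>k\<in>A \<inter> {..<m}. pmf (p n) k) \<longlonglongrightarrow> (\<Sum>k\<in>A \<inter> {..<m}. pmf q k)"
    by (intro tendsto_sum assms(1))
  then have "(\<lambda>n. measure_pmf.prob (p n) (A \<inter> {..<m})) \<longlonglongrightarrow> measure_pmf.prob q (A \<inter> {..<m})"
    by (simp add: measure_measure_pmf_finite)
  then have "\<forall>\<^sub>F n in sequentially. a < measure_pmf.prob (p n) (A \<inter> {..<m})"
    using m by (rule order_tendstoD)
  then show ?thesis
  proof eventually_elim
    case (elim n)
    also have "measure_pmf.prob (p n) (A \<inter> {..<m}) \<le> measure_pmf.prob (p n) A"
      by (intro measure_pmf.finite_measure_mono) auto
    finally show ?case .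
  qed
qed

text \<open>Applying the one-sided bound to \<open>A\<close> and to its complement traps the probability of \<open>A\<close>;
  this is Scheffe's argument, and it uses that the limit has total mass one.\<close>

lemma pmf_tendsto_imp_prob_tendsto:
  fixes p :: "nat \<Rightarrow> nat pmf" and q :: "nat pmf"
  assumes "\<And>k. (\<lambda>n. pmf (p n) k) \<longlonglongrightarrow> pmf q k"
  shows "(\<lambda>n. measure_pmf.prob (p n) A) \<longlonglongrightarrow> measure_pmf.prob q A"
proof (rule order_tendstoI)
  fix a assume "a < measure_pmf.prob q A"
  with assms show "\<forall>\<^sub>F n in sequentially. a < measure_pmf.prob (p n) A"
    by (rule pmf_tendsto_imp_prob_eventually_greater)
next
  fix a assume a: "measure_pmf.prob q A < a"
  have compl: "measure_pmf.prob s (- A) = 1 - measure_pmf.prob s A" for s :: "nat pmf"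
    using measure_pmf.prob_compl[of A s] by (simp add: Compl_eq_Diff_UNIV)
  have "1 - a < measure_pmf.prob q (- A)" using a by (simp add: compl)
  with assms have "\<forall>\<^sub>F n in sequentially. 1 - a < measure_pmf.prob (p n) (- A)"
    by (rule pmf_tendsto_imp_prob_eventually_greater)
  then show "\<forall>\<^sub>F n in sequentially. measure_pmf.prob (p n) A < a"
    by (simp add: compl)
qed

lemma pmf_tendsto_imp_weak_conv_distr:
  fixes p :: "nat \<Rightarrow> nat pmf" and q :: "nat pmf" and g :: "nat \<Rightarrow> real"
  assumes "\<And>k. (\<lambda>n. pmf (p n) k) \<longlonglongrightarrow> pmf q k"
  shows "weak_conv_m (\<lambda>n. distr (measure_pmf (p n)) borel g) (distr (measure_pmf q) borel g)"
proof -
  have "cdf (distr (measure_pmf s) borel g) x = measure_pmf.prob s {k. g k \<le> x}"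
    for s :: "nat pmf" and x
    by (simp add: cdf_def2 measure_distr vimage_def)
  then show ?thesis
    using pmf_tendsto_imp_prob_tendsto[OF assms]
    by (simp add: weak_conv_m_def weak_conv_def)
qed

section \<open>Asymptotics of binomial probabilities\<close>

lemma one_minus_power_tendsto_exp:
  fixes p :: "nat \<Rightarrow> real"
  assumes p: "\<And>n. 0 \<le> p n" "p \<longlonglongrightarrow> 0" and np: "(\<lambda>n. real n * p n) \<longlonglongrightarrow> l"
  shows "(\<lambda>n. (1 - p n) ^ n) \<longlonglongrightarrow> exp (- l)"
proof (rule tendsto_sandwich)
  have small: "\<forall>\<^sub>F n in sequentially. p n < 1"
    using p(2) by (rule order_tendstoD) simp
  \<comment> \<open>The bound \<open>1 + x \<le> exp x\<close> is used at \<open>x = - p\<close> for the upper estimate and at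
    \<open>x = p / (1 - p)\<close>, where \<open>1 + x = 1 / (1 - p)\<close>, for the lower one.\<close>
  show "\<forall>\<^sub>F n in sequentially. (1 - p n) ^ n \<le> exp (- (real n * p n))"
    using small
  proof eventually_elim
    case (elim n)
    have "(1 - p n) ^ n \<le> exp (- p n) ^ n"
      using elim exp_ge_add_one_self[of "- p n"] by (intro power_mono) auto
    then show ?case by (simp add: exp_of_nat_mult[symmetric])
  qed
  show "\<forall>\<^sub>F n in sequentially. exp (- (real n * p n / (1 - p n))) \<le> (1 - p n) ^ n"
    using small
  proof eventually_elim
    case (elim n)
    have "1 / (1 - p n) = 1 + p n / (1 - p n)" using elim by (simp add: field_simps)
    also have "\<dots> \<le> exp (p n / (1 - p n))" by (rule exp_ge_add_one_self)
    finally have "exp (- (p n / (1 - p n))) \<le> 1 - p n"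
      using elim by (simp add: exp_minus field_simps)
    then have "exp (- (p n / (1 - p n))) ^ n \<le> (1 - p n) ^ n"
      by (intro power_mono) auto
    then show ?case by (simp add: exp_of_nat_mult[symmetric])
  qed
  show "(\<lambda>n. exp (- (real n * p n))) \<longlonglongrightarrow> exp (- l)"
    by (intro tendsto_intros np)
  have "(\<lambda>n. exp (- (real n * p n / (1 - p n)))) \<longlonglongrightarrow> exp (- (l / (1 - 0)))"
    by (intro tendsto_intros np p(2)) simp
  then show "(\<lambda>n. exp (- (real n * p n / (1 - p n)))) \<longlonglongrightarrow> exp (- l)" by simp
qed

lemma tendsto_zero_if_of_nat_mult_tendsto:
  fixes p :: "nat \<Rightarrow> real"
  assumes "(\<lambda>n. real n * p n) \<longlonglongrightarrow> l"
  shows "p \<longlonglongrightarrow> 0"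
proof -
  have "(\<lambda>n. (real n * p n) * inverse (real n)) \<longlonglongrightarrow> l * 0"
    by (intro tendsto_mult assms lim_inverse_n)
  moreover have "\<forall>\<^sub>F n in sequentially. (real n * p n) * inverse (real n) = p n"
    using eventually_gt_at_top[of 0] by eventually_elim (simp add: field_simps)
  ultimately show ?thesis by (simp add: tendsto_cong)
qed

text \<open>The law of rare events. The factor \<open>(n choose k) * p ^ k\<close> is \<open>1 / fact k\<close> times the product
  of the \<open>k\<close> numbers \<open>n * p - i * p\<close>, each of which tends to \<open>l\<close>, and the \<open>k\<close> factors missing
  from the power of \<open>1 - p\<close> tend to one. The formula covers \<open>l = 0\<close>, where the limit
  is the point mass at zero.\<close>

lemma binomial_poisson_limit:
  fixes p :: "nat \<Rightarrow> real"
  assumes p01: "\<And>n. p n \<in> {0..1}" and np: "(\<lambda>n. real n * p n) \<longlonglongrightarrow> l"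
  shows "(\<lambda>n. pmf (binomial_pmf n (p n)) k) \<longlonglongrightarrow> l ^ k / fact k * exp (- l)"
proof -
  have p0: "p \<longlonglongrightarrow> 0" using np by (rule tendsto_zero_if_of_nat_mult_tendsto)
  have "(\<lambda>n. (\<Prod>i<k. real n * p n - real i * p n) / fact k * ((1 - p n) ^ n / (1 - p n) ^ k))
      \<longlonglongrightarrow> (\<Prod>i<k. l - real i * 0) / fact k * (exp (- l) / (1 - 0) ^ k)"
    using p01 by (intro tendsto_intros np p0 one_minus_power_tendsto_exp) auto
  moreover have "\<forall>\<^sub>F n in sequentially.
      (\<Prod>i<k. real n * p n - real i * p n) / fact k * ((1 - p n) ^ n / (1 - p n) ^ k)
      = pmf (binomial_pmf n (p n)) k"
    using order_tendstoD(2)[OF p0 zero_less_one] eventually_ge_at_top[of k]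
  proof eventually_elim
    case (elim n)
    have "(\<Prod>i<k. real n * p n - real i * p n) = (\<Prod>i<k. (real n - real i) * p n)"
      by (simp add: left_diff_distrib)
    also have "\<dots> = (\<Prod>i<k. real n - real i) * p n ^ k"
      by (simp add: prod.distrib)
    also have "\<dots> / fact k = real (n choose k) * p n ^ k"
      by (simp add: binomial_gbinomial gbinomial_prod_rev atLeast0LessThan)
    finally have "(\<Prod>i<k. real n * p n - real i * p n) / fact k = real (n choose k) * p n ^ k" .
    moreover have "(1 - p n) ^ n / (1 - p n) ^ k = (1 - p n) ^ (n - k)"
      using elim by (simp add: power_diff)
    ultimately show ?case
      using p01[of n] by simp
  qed
  ultimately have "(\<lambda>n. pmf (binomial_pmf n (p n)) k)
      \<longlonglongrightarrow> (\<Prod>i<k. l - real i * 0) / fact k * (exp (- l) / (1 - 0) ^ k)"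
    by (rule Lim_transform_eventually)
  then show ?thesis by simp
qed

text \<open>A form of the bound that depends on \<open>n\<close> and \<open>p\<close> only through the mean \<open>n * p\<close>. The constant
  \<open>exp k\<close> pays for replacing the exponent \<open>n - k\<close> of \<open>1 - p \<le> exp (- p)\<close> by \<open>n\<close>.\<close>

lemma pmf_binomial_le:
  assumes "p \<in> {0..1}"
  shows "pmf (binomial_pmf n p) k \<le> exp (real k) * ((real n * p) ^ k / exp (real n * p))"
proof (cases "k \<le> n")
  case False
  then have "pmf (binomial_pmf n p) k = 0" using assms by simp
  moreover have "0 \<le> real n * p" using assms by simp
  ultimately show ?thesis by (simp del: pmf_binomial)
next
  case True
  have "(1 - p) ^ (n - k) \<le> exp (- p) ^ (n - k)"
    using assms exp_ge_add_one_self[of "- p"] by (intro power_mono) auto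
  also have "\<dots> = exp (real k * p - real n * p)"
    using True by (simp add: exp_of_nat_mult[symmetric] of_nat_diff algebra_simps)
  also have "\<dots> \<le> exp (real k - real n * p)"
    using assms by (simp add: mult_left_le)
  finally have e: "(1 - p) ^ (n - k) \<le> exp (real k - real n * p)" .
  have "real (n choose k) \<le> real (n ^ k)"
    using True binomial_le_pow of_nat_le_iff by blast
  then have "real (n choose k) * p ^ k \<le> (real n * p) ^ k"
    using assms by (simp add: power_mult_distrib mult_right_mono)
  then have "real (n choose k) * p ^ k * (1 - p) ^ (n - k)
      \<le> (real n * p) ^ k * exp (real k - real n * p)"
    using e assms by (intro mult_mono) auto
  then show ?thesis
    using assms by (simp add: exp_diff mult_ac)
qed

lemma prob_binomial_lessThan_tendsto_zero:
  fixes p :: "nat \<Rightarrow> real"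
  assumes p01: "\<And>n. p n \<in> {0..1}" and np: "filterlim (\<lambda>n. real n * p n) at_top sequentially"
  shows "(\<lambda>n. measure_pmf.prob (binomial_pmf n (p n)) {..<m}) \<longlonglongrightarrow> 0"
proof -
  have "(\<lambda>n. pmf (binomial_pmf n (p n)) k) \<longlonglongrightarrow> 0" for k
  proof (rule tendsto_sandwich[OF always_eventually always_eventually tendsto_const])
    show "\<forall>n. 0 \<le> pmf (binomial_pmf n (p n)) k" by (simp del: pmf_binomial)
    show "\<forall>n. pmf (binomial_pmf n (p n)) k
        \<le> exp (real k) * ((real n * p n) ^ k / exp (real n * p n))"
      using pmf_binomial_le[OF p01] by blast
    have "(\<lambda>n. exp (real k) * ((real n * p n) ^ k / exp (real n * p n))) \<longlonglongrightarrow> exp (real k) * 0"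
      by (intro tendsto_mult tendsto_const filterlim_compose[OF tendsto_power_div_exp_0 np])
    then show "(\<lambda>n. exp (real k) * ((real n * p n) ^ k / exp (real n * p n))) \<longlonglongrightarrow> 0" by simp
  qed
  then have "(\<lambda>n. \<Sum>k<m. pmf (binomial_pmf n (p n)) k) \<longlonglongrightarrow> (\<Sum>k<m. 0)"
    by (intro tendsto_sum)
  then show ?thesis by (simp add: measure_measure_pmf_finite del: pmf_binomial)
qed

section \<open>The three regimes\<close>

lemma divide_le_choose:
  assumes "r \<ge> 1" "r \<le> m"
  shows "real m / real r \<le> real (m choose r)"
proof -
  have "real m / real r \<le> (real m / real r) ^ r"
    using assms by (intro self_le_power) auto
  also have "\<dots> \<le> real (m choose r)"
    using assms(2) by (rule binomial_ge_n_over_k_pow_k)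
  finally show ?thesis .
qed

theorem proposition1p1:
  fixes r :: nat and c :: "nat \<Rightarrow> nat"
  assumes "r \<ge> 1" and "\<And>n. c n \<ge> 1"
  shows "((\<lambda>n. real n / real (c n)) \<longlonglongrightarrow> 0 \<longrightarrow>
            weak_conv_m (\<lambda>n. mono_stars_law r n (c n)) (return borel 0)) \<and>
         (filterlim (\<lambda>n. real n / real (c n)) at_top sequentially \<longrightarrow>
            (\<forall>K::real. (\<lambda>n. measure_pmf.prob (random_colouring (star_graph n) (c n))
                          {f. real (mono_stars r (star_graph n) f) > K}) \<longlonglongrightarrow> 1)) \<and>
         (\<forall>l::real. 0 < l \<longrightarrow> (\<lambda>n. real n / real (c n)) \<longlonglongrightarrow> l \<longrightarrow>
            weak_conv_m (\<lambda>n. mono_stars_law r n (c n))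
              (distr (measure_pmf (poisson_pmf l)) borel
                 (\<lambda>x. (\<Prod>i<r. real x - real i) / fact r)))"
proof (intro conjI impI allI)
  define p where "p n = 1 / real (c n)" for n
  have p01: "p n \<in> {0..1}" for n
    using assms(2)[of n] by (simp add: p_def)
  have np: "(\<lambda>n. real n / real (c n)) = (\<lambda>n. real n * p n)"
    by (simp add: p_def)
  have law: "mono_stars_law r n (c n)
      = distr (measure_pmf (binomial_pmf n (p n))) borel (\<lambda>m. real (m choose r))" for n
    unfolding p_def using assms by (rule mono_stars_law_binomial)
  {
    assume "(\<lambda>n. real n / real (c n)) \<longlonglongrightarrow> 0"
    then have lim: "(\<lambda>n. real n * p n) \<longlonglongrightarrow> 0" by (simp only: np)
    have "(\<lambda>n. pmf (binomial_pmf n (p n)) k) \<longlonglongrightarrow> pmf (return_pmf 0) k" for k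
    proof -
      have "(0::real) ^ k / fact k * exp (- 0) = pmf (return_pmf 0) k"
        by (cases k) auto
      then show ?thesis
        using binomial_poisson_limit[OF p01 lim, of k] by (simp only:)
    qed
    then have "weak_conv_m (\<lambda>n. mono_stars_law r n (c n))
        (distr (measure_pmf (return_pmf 0)) borel (\<lambda>m. real (m choose r)))"
      unfolding law by (rule pmf_tendsto_imp_weak_conv_distr)
    moreover have "distr (measure_pmf (return_pmf 0)) borel (\<lambda>m. real (m choose r)) = return borel 0"
    proof -
      have "0 choose r = 0" using assms(1) by (intro binomial_eq_0) simp
      moreover have "distr (measure_pmf (return_pmf 0)) borel (\<lambda>m. real (m choose r))
          = return borel (real (0 choose r))"
        by (simp add: return_pmf.rep_eq distr_return)
      ultimately show ?thesis by (simp only: of_nat_0)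
    qed
    ultimately show "weak_conv_m (\<lambda>n. mono_stars_law r n (c n)) (return borel 0)" by simp
  }
  {
    fix K :: real
    assume "filterlim (\<lambda>n. real n / real (c n)) at_top sequentially"
    then have lim: "filterlim (\<lambda>n. real n * p n) at_top sequentially" by (simp only: np)
    obtain m0 where m0: "real r * K < real m0" using reals_Archimedean2 by blast
    define m where "m = max r m0"
    have large: "K < real (N choose r)" if "m \<le> N" for N
    proof -
      have "real r * K < real N" using m0 that by (simp add: m_def)
      then have "K < real N / real r" using assms(1) by (simp add: field_simps)
      also have "\<dots> \<le> real (N choose r)"
        using assms(1) that by (intro divide_le_choose) (auto simp: m_def)
      finally show ?thesis .
    qed
    have eq: "measure_pmf.prob (random_colouring (star_graph n) (c n))
        {f. real (mono_stars r (star_graph n) f) > K}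
      = measure_pmf.prob (binomial_pmf n (p n)) {N. real (N choose r) > K}" for n
    proof -
      have "measure_pmf.prob (map_pmf (mono_stars r (star_graph n))
              (random_colouring (star_graph n) (c n))) {t. real t > K}
          = measure_pmf.prob (map_pmf (\<lambda>N. N choose r) (binomial_pmf n (p n))) {t. real t > K}"
        unfolding p_def by (simp only: mono_stars_binomial[OF assms])
      then show ?thesis by (simp add: vimage_def)
    qed
    have lower: "1 - measure_pmf.prob (binomial_pmf n (p n)) {..<m}
        \<le> measure_pmf.prob (binomial_pmf n (p n)) {N. real (N choose r) > K}" for n
    proof -
      have "1 - measure_pmf.prob (binomial_pmf n (p n)) {..<m}
          = measure_pmf.prob (binomial_pmf n (p n)) (- {..<m})"
        using measure_pmf.prob_compl[of "{..<m}" "binomial_pmf n (p n)"]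
        by (simp add: Compl_eq_Diff_UNIV)
      also have "\<dots> \<le> measure_pmf.prob (binomial_pmf n (p n)) {N. real (N choose r) > K}"
        using large by (intro measure_pmf.finite_measure_mono) auto
      finally show ?thesis .
    qed
    have "(\<lambda>n. measure_pmf.prob (binomial_pmf n (p n)) {N. real (N choose r) > K}) \<longlonglongrightarrow> 1"
    proof (rule tendsto_sandwich[OF always_eventually always_eventually _ tendsto_const])
      have "(\<lambda>n. 1 - measure_pmf.prob (binomial_pmf n (p n)) {..<m}) \<longlonglongrightarrow> 1 - 0"
        by (intro tendsto_diff tendsto_const prob_binomial_lessThan_tendsto_zero p01 lim)
      then show "(\<lambda>n. 1 - measure_pmf.prob (binomial_pmf n (p n)) {..<m}) \<longlonglongrightarrow> 1" by simp
    qed (use lower in auto)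
    then show "(\<lambda>n. measure_pmf.prob (random_colouring (star_graph n) (c n))
        {f. real (mono_stars r (star_graph n) f) > K}) \<longlonglongrightarrow> 1"
      by (simp only: eq)
  }
  {
    fix l :: real
    assume l: "0 < l" and "(\<lambda>n. real n / real (c n)) \<longlonglongrightarrow> l"
    then have lim: "(\<lambda>n. real n * p n) \<longlonglongrightarrow> l" by (simp only: np)
    have "(\<lambda>n. pmf (binomial_pmf n (p n)) k) \<longlonglongrightarrow> pmf (poisson_pmf l) k" for k
      using binomial_poisson_limit[OF p01 lim, of k] l by simp
    then have "weak_conv_m (\<lambda>n. mono_stars_law r n (c n))
        (distr (measure_pmf (poisson_pmf l)) borel (\<lambda>m. real (m choose r)))"
      unfolding law by (rule pmf_tendsto_imp_weak_conv_distr)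
    moreover have "(\<lambda>m. real (m choose r)) = (\<lambda>x. (\<Prod>i<r. real x - real i) / fact r)"
      by (simp add: binomial_gbinomial gbinomial_prod_rev atLeast0LessThan)
    ultimately show "weak_conv_m (\<lambda>n. mono_stars_law r n (c n))
        (distr (measure_pmf (poisson_pmf l)) borel (\<lambda>x. (\<Prod>i<r. real x - real i) / fact r))"
      by simp
  }
qed

end
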